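(* For every integer $d\ge1$, every $z\ge1$, $0<\varepsilon<1$, $c\in\mathbb{R}^d$, $r>0$ and every finite ring data set $R\subseteq\mathrm{ring}(c,r,2r)\subseteq\mathbb{R}^d$, there exists an $(\varepsilon,\mathrm{cost}_z(R,c))$-coreset for $(1,z)$-Clustering on $R$ of size $\tilde O_z\big(\varepsilon^{-(2-2/(d+2))}\big)$, where the $O$-notation hides a factor polynomial in $d$.
   Context: Distances are Euclidean; $\mathrm{ring}(c,a,b)=\{x\in\mathbb{R}^d:a<\|x-c\|_2\le b\}$. For a finite weighted set $Q$ (unit weights if unweighted) and $y\in\mathbb{R}^d$, $\mathrm{cost}_z(Q,y)=\sum_{x\in Q}w_Q(x)\|x-y\|_2^z$. A weighted set $S$ is an $(\varepsilon,A)$-coreset for $(1,z)$-Clustering on $R$ if for every $y\in\mathbb{R}^d$, $|\mathrm{cost}_z(R,y)-\mathrm{cost}_z(S,y)|\le\varepsilon(\mathrm{cost}_z(R,y)+A)$. $\tilde O_z$ hides factors depending only on $z$ and polylogarithmic factors. *)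

theory Defs
  imports "HOL-Analysis.Analysis"
begin

text \<open>
  The dimension $d$ is quantified inside the main statement (the constants there must not depend
  on it), so $R^d$ cannot be a type. It is the library's \<open>topspace (Euclidean_space d)\<close>, the set of
  functions \<open>nat \<Rightarrow> real\<close> that vanish at all indices from \<open>d\<close> on.
\<close>

type_synonym point = "nat \<Rightarrow> real"

abbreviation Rspace :: "nat \<Rightarrow> point set" where
  "Rspace d \<equiv> topspace (Euclidean_space d)"

definition edist :: "nat \<Rightarrow> point \<Rightarrow> point \<Rightarrow> real" where
  "edist d x y = L2_set (\<lambda>i. x i - y i) {..<d}"

definition ring_region :: "nat \<Rightarrow> point \<Rightarrow> real \<Rightarrow> real \<Rightarrow> point set" where
  "ring_region d c a b = {x \<in> Rspace d. a < edist d x c \<and> edist d x c \<le> b}"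

text \<open>
  A weighted set is a pair of a point set and a weight function; weights outside the set are
  irrelevant. An unweighted set carries the weight function \<open>unit_weight\<close>.
\<close>

definition weighted_set :: "nat \<Rightarrow> point set \<Rightarrow> (point \<Rightarrow> real) \<Rightarrow> bool" where
  "weighted_set d Q w \<longleftrightarrow> finite Q \<and> Q \<subseteq> Rspace d \<and> (\<forall>x\<in>Q. 0 \<le> w x)"

definition unit_weight :: "point \<Rightarrow> real" where
  "unit_weight x = 1"

definition cost :: "nat \<Rightarrow> real \<Rightarrow> point set \<Rightarrow> (point \<Rightarrow> real) \<Rightarrow> point \<Rightarrow> real" where
  "cost d z Q w y = (\<Sum>x\<in>Q. w x * edist d x y powr z)"

definition is_coreset ::
  "nat \<Rightarrow> real \<Rightarrow> real \<Rightarrow> real \<Rightarrow> point set \<Rightarrow> (point \<Rightarrow> real) \<Rightarrow> point set \<Rightarrow> (point \<Rightarrow> real) \<Rightarrow> bool"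
where
  "is_coreset d z \<epsilon> A R wR S wS \<longleftrightarrow>
     weighted_set d S wS \<and>
     (\<forall>y\<in>Rspace d. \<bar>cost d z R wR y - cost d z S wS y\<bar> \<le> \<epsilon> * (cost d z R wR y + A))"

end

theory Submission
  imports Defs
begin

text \<open>
  Stratified sampling in one shot. Fix a target size \<open>m\<close>. A grid with at most \<open>m\<close> cells of side
  \<open>O(r m^(-1/d))\<close>, whose cells are further split into groups of at most \<open>2n/m\<close> points each, partitions \<open>R\<close>
  into at most \<open>2m\<close> groups. Replace every group by one of its points, weighted by the size of the
  group. For a centre \<open>y\<close> at distance \<open>D\<close> from \<open>c\<close> the map \<open>x \<mapsto> dist(x,y)^z / (r+D)^z\<close> is
  \<open>O(1/r)\<close>-Lipschitz on the ring, so a uniformly random choice of representatives has relative error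
  \<open>m^(-1/2-1/d)\<close> up to a factor polynomial in \<open>d\<close> and logarithmic in \<open>1/\<epsilon>\<close>, simultaneously for all \<open>y\<close>
  in a net of size \<open>(O(d)/\<epsilon>^2)^d\<close>. Centres farther than \<open>O(r/\<epsilon>)\<close> need no net because the total weight
  is preserved exactly. Since \<open>cost(R,y) + cost(R,c) \<ge> n ((r+D)/4)^z\<close>, a size of order
  \<open>\<epsilon>^(-2d/(d+2))\<close> suffices, which is even below the claimed bound.
\<close>

section \<open>Exponential moments and derandomised selection of representatives\<close>

text \<open>For \<open>x \<le> 1\<close> one has \<open>exp x \<le> 1 + x + x\<^sup>2\<close> and
  \<open>1 + x\<^sup>2 \<le> exp (x\<^sup>2)\<close>; for \<open>x > 1\<close> already
  \<open>x \<le> x\<^sup>2\<close>. Keeping the linear term separate lets it cancel when summed over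
  deviations of mean zero.\<close>

lemma exp_le_add_exp_square: "exp x \<le> x + exp (x\<^sup>2)" for x :: real
proof -
  consider "x > 1" | "0 \<le> x" "x \<le> 1" | "x < 0" by linarith
  then show ?thesis
  proof cases
    case 1
    then have "x \<le> x\<^sup>2" by (simp add: power2_eq_square)
    then have "exp x \<le> exp (x\<^sup>2)" by simp
    then show ?thesis using 1 by linarith
  next
    case 2
    then have "exp x \<le> 1 + x + x\<^sup>2" by (rule exp_bound)
    then show ?thesis using exp_ge_add_one_self[of "x\<^sup>2"] by linarith
  next
    case 3
    define u where "u = - x"
    have u: "u > 0" using 3 by (simp add: u_def)
    \<comment> \<open>It suffices that \<open>(1 - u + u\<^sup>2) * exp u\<close> is at least 1, and
      the quadratic Taylor bound for \<open>exp u\<close> is enough: the product has no linear term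
      and only nonnegative further ones.\<close>
    have "1 \<le> (1 - u + u\<^sup>2) * (1 + u + u\<^sup>2 / 2)"
    proof -
      have "(1 - u + u\<^sup>2) * (1 + u + u\<^sup>2 / 2) = 1 + u^2/2 + u^3/2 + u^4/2"
        by (simp add: field_simps power2_eq_square power3_eq_cube power4_eq_xxxx)
      then show ?thesis using u by simp
    qed
    also have "\<dots> \<le> (1 - u + u\<^sup>2) * exp u"
    proof (rule mult_left_mono)
      show "1 + u + u\<^sup>2 / 2 \<le> exp u" using exp_lower_Taylor_quadratic[of u] u by simp
      have "1 - u + u\<^sup>2 = (u - 1/2)\<^sup>2 + 3/4" by (simp add: power2_eq_square field_simps)
      then show "0 \<le> 1 - u + u\<^sup>2" by simp
    qed
    finally have "exp (-u) \<le> 1 - u + u\<^sup>2" by (simp add: exp_minus field_simps)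
    then have "exp x \<le> 1 + x + x\<^sup>2" by (simp add: u_def)
    then show ?thesis using exp_ge_add_one_self[of "x\<^sup>2"] by linarith
  qed
qed

text \<open>The deviations \<open>D s\<close> sum to zero over the group, so the linear terms of
  \<open>exp_le_add_exp_square\<close> vanish, and each \<open>D s\<close> is at most
  \<open>card G * b\<close> in absolute value. This is the moment bound for one uniformly chosen
  representative, multiplied by \<open>card G\<close>.\<close>

lemma sum_exp_deviations_le:
  fixes g :: "'a \<Rightarrow> real"
  assumes "finite G" and osc: "\<And>x x'. x \<in> G \<Longrightarrow> x' \<in> G \<Longrightarrow> \<bar>g x - g x'\<bar> \<le> b"
  shows "(\<Sum>s\<in>G. exp (l * (\<Sum>x\<in>G. g s - g x))) \<le> real (card G) * exp (l\<^sup>2 * (real (card G) * b)\<^sup>2)"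
proof -
  define D where "D s = (\<Sum>x\<in>G. g s - g x)" for s
  have D: "\<bar>D s\<bar> \<le> real (card G) * b" if "s \<in> G" for s
    unfolding D_def
    using order_trans[OF sum_abs sum_bounded_above[of G "\<lambda>x. \<bar>g s - g x\<bar>" b]] osc[OF that]
    by blast
  have sum0: "(\<Sum>s\<in>G. D s) = 0"
    by (simp add: D_def sum_subtractf sum_distrib_left)
  have "(\<Sum>s\<in>G. exp (l * D s)) \<le> (\<Sum>s\<in>G. l * D s + exp (l\<^sup>2 * (real (card G) * b)\<^sup>2))"
  proof (rule sum_mono)
    fix s assume "s \<in> G"
    have "(D s)\<^sup>2 \<le> (real (card G) * b)\<^sup>2" using D[OF \<open>s \<in> G\<close>] by (rule abs_le_square_iff[THEN iffD1, OF order_trans]) simp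
    then have "(l * D s)\<^sup>2 \<le> l\<^sup>2 * (real (card G) * b)\<^sup>2"
      by (simp add: power_mult_distrib[of l] mult_left_mono)
    then show "exp (l * D s) \<le> l * D s + exp (l\<^sup>2 * (real (card G) * b)\<^sup>2)"
      using exp_le_add_exp_square[of "l * D s"] by (smt (verit) exp_le_cancel_iff)
  qed
  also have "\<dots> = real (card G) * exp (l\<^sup>2 * (real (card G) * b)\<^sup>2)"
    by (simp add: sum.distrib sum0 flip: sum_distrib_left)
  finally show ?thesis by (simp add: D_def)
qed

text \<open>
  Derandomised Hoeffding bound: representatives are chosen group by group, each time one for which
  the exponential potential grows by at most its average factor.
\<close>

lemma exists_selection_exp_moment:
  fixes F :: "('a \<Rightarrow> real) set"
  assumes "finite P" and "finite F"
    and "\<And>G. G \<in> P \<Longrightarrow> finite G \<and> G \<noteq> {}"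
    and "\<And>g G x x'. g \<in> F \<Longrightarrow> G \<in> P \<Longrightarrow> x \<in> G \<Longrightarrow> x' \<in> G \<Longrightarrow> \<bar>g x - g x'\<bar> \<le> b"
  shows "\<exists>s. (\<forall>G\<in>P. s G \<in> G) \<and>
    (\<Sum>g\<in>F. exp (l * (\<Sum>G\<in>P. \<Sum>x\<in>G. g (s G) - g x)))
      \<le> real (card F) * exp (l\<^sup>2 * (\<Sum>G\<in>P. (real (card G) * b)\<^sup>2))"
  using assms(1,3,4)
proof (induction P rule: finite_induct)
  case empty
  then show ?case by simp
next
  case (insert G P)
  have "\<exists>s. (\<forall>G\<in>P. s G \<in> G) \<and>
    (\<Sum>g\<in>F. exp (l * (\<Sum>G\<in>P. \<Sum>x\<in>G. g (s G) - g x)))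
      \<le> real (card F) * exp (l\<^sup>2 * (\<Sum>G\<in>P. (real (card G) * b)\<^sup>2))"
    by (rule insert.IH) (use insert.prems in blast)+
  then obtain s where s: "\<And>G. G \<in> P \<Longrightarrow> s G \<in> G"
    "(\<Sum>g\<in>F. exp (l * (\<Sum>G\<in>P. \<Sum>x\<in>G. g (s G) - g x)))
      \<le> real (card F) * exp (l\<^sup>2 * (\<Sum>G\<in>P. (real (card G) * b)\<^sup>2))"
    by blast
  define T where "T g = exp (l * (\<Sum>G\<in>P. \<Sum>x\<in>G. g (s G) - g x))" for g
  define D where "D g a = exp (l * (\<Sum>x\<in>G. g a - g x))" for g a
  define q where "q = exp (l\<^sup>2 * (real (card G) * b)\<^sup>2)"
  have G: "finite G" "G \<noteq> {}" using insert.prems(1) by auto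
  \<comment> \<open>Averaging argument: \<open>T\<close> is the potential of the groups treated so
    far and \<open>D\<close> the factor contributed by the new group. If every \<open>a\<close>
    exceeded the bound, so would the average over \<open>G\<close>, against
    \<open>sum_exp_deviations_le\<close>.\<close>
  have "\<exists>a\<in>G. (\<Sum>g\<in>F. T g * D g a) \<le> q * (\<Sum>g\<in>F. T g)"
  proof (rule ccontr)
    assume "\<not> ?thesis"
    then have "(\<Sum>a\<in>G. q * (\<Sum>g\<in>F. T g)) < (\<Sum>a\<in>G. \<Sum>g\<in>F. T g * D g a)"
      using G by (intro sum_strict_mono) auto
    also have "\<dots> = (\<Sum>g\<in>F. T g * (\<Sum>a\<in>G. D g a))"
      by (subst sum.swap) (simp add: sum_distrib_left)
    also have "\<dots> \<le> (\<Sum>g\<in>F. T g * (real (card G) * q))"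
      unfolding D_def q_def using G insert.prems(2)
      by (intro sum_mono mult_left_mono sum_exp_deviations_le) (auto simp: T_def)
    also have "\<dots> = (\<Sum>a\<in>G. q * (\<Sum>g\<in>F. T g))"
      by (simp add: sum_distrib_left mult_ac)
    finally show False by simp
  qed
  then obtain a where a: "a \<in> G" "(\<Sum>g\<in>F. T g * D g a) \<le> q * (\<Sum>g\<in>F. T g)" by blast
  define s' where "s' = s(G := a)"
  have eq: "exp (l * (\<Sum>H\<in>insert G P. \<Sum>x\<in>H. g (s' H) - g x)) = T g * D g a" for g
  proof -
    have "(\<Sum>H\<in>P. \<Sum>x\<in>H. g (s' H) - g x) = (\<Sum>H\<in>P. \<Sum>x\<in>H. g (s H) - g x)"
      using insert.hyps by (intro sum.cong) (auto simp: s'_def)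
    then show ?thesis
      using insert.hyps by (simp add: s'_def T_def D_def distrib_left exp_add)
  qed
  have "(\<Sum>g\<in>F. T g * D g a) \<le> q * (\<Sum>g\<in>F. T g)" by (fact a)
  also have "\<dots> \<le> q * (real (card F) * exp (l\<^sup>2 * (\<Sum>G\<in>P. (real (card G) * b)\<^sup>2)))"
    using s(2) by (intro mult_left_mono) (auto simp: q_def T_def)
  also have "\<dots> = real (card F) * exp (l\<^sup>2 * (\<Sum>G\<in>insert G P. (real (card G) * b)\<^sup>2))"
    using insert.hyps by (simp add: q_def distrib_left exp_add)
  finally have "(\<Sum>g\<in>F. exp (l * (\<Sum>H\<in>insert G P. \<Sum>x\<in>H. g (s' H) - g x)))
      \<le> real (card F) * exp (l\<^sup>2 * (\<Sum>G\<in>insert G P. (real (card G) * b)\<^sup>2))"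
    by (simp only: eq)
  moreover have "\<forall>H\<in>insert G P. s' H \<in> H" using a s(1) insert.hyps by (auto simp: s'_def)
  ultimately show ?case by blast
qed

text \<open>Chernoff argument: each single exponential is at most the whole sum, so taking
  logarithms in the moment bound controls every deviation at once. The price for simultaneity is the
  factor \<open>ln (2 * M)\<close>.\<close>

lemma exists_selection_small_deviation:
  fixes F :: "('a \<Rightarrow> real) set"
  assumes "finite P" and "finite F"
    and G: "\<And>G. G \<in> P \<Longrightarrow> finite G \<and> G \<noteq> {}"
    and osc: "\<And>g G x x'. g \<in> F \<Longrightarrow> G \<in> P \<Longrightarrow> x \<in> G \<Longrightarrow> x' \<in> G \<Longrightarrow> \<bar>g x - g x'\<bar> \<le> b"
    and cG: "\<And>G. G \<in> P \<Longrightarrow> real (card G) \<le> B" and cP: "real (card P) \<le> N"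
    and cF: "real (card F) \<le> M" "1 \<le> M"
    and "0 \<le> b" "0 < e"
    and e: "4 * N * (B * b)\<^sup>2 * ln (2 * M) \<le> e\<^sup>2"
  shows "\<exists>s. (\<forall>G\<in>P. s G \<in> G) \<and> (\<forall>g\<in>F. \<bar>\<Sum>G\<in>P. \<Sum>x\<in>G. g (s G) - g x\<bar> \<le> e)"
proof -
  \<comment> \<open>Adding the negatives makes the one-sided bound two-sided and at most doubles the
    number of functions.\<close>
  define F' where "F' = F \<union> (\<lambda>g x. - g x) ` F"
  \<comment> \<open>With this \<open>l\<close> the term \<open>ln (2 * M)\<close> equals
    \<open>l * e / 2\<close>, and the hypothesis on \<open>e\<close> bounds \<open>l * V\<close> by
    the other half of \<open>e\<close>.\<close>
  define l where "l = 2 * ln (2 * M) / e"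
  define V where "V = (\<Sum>G\<in>P. (real (card G) * b)\<^sup>2)"
  have lpos: "ln (2 * M) > 0" "l > 0" using cF(2) \<open>0 < e\<close> by (auto simp: l_def)
  have "finite F'" using \<open>finite F\<close> by (simp add: F'_def)
  have osc': "\<bar>g x - g x'\<bar> \<le> b" if "g \<in> F'" "G \<in> P" "x \<in> G" "x' \<in> G" for g G x x'
    using that osc[OF _ that(2,3,4)] osc[OF _ that(2,4,3)] by (auto simp: F'_def)
  have "\<exists>s. (\<forall>G\<in>P. s G \<in> G) \<and>
    (\<Sum>g\<in>F'. exp (l * (\<Sum>G\<in>P. \<Sum>x\<in>G. g (s G) - g x))) \<le> real (card F') * exp (l\<^sup>2 * V)"
    unfolding V_def
    by (rule exists_selection_exp_moment[OF \<open>finite P\<close> \<open>finite F'\<close>]) (use G osc' in blast)+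
  then obtain s where s: "\<forall>G\<in>P. s G \<in> G"
    and mom: "(\<Sum>g\<in>F'. exp (l * (\<Sum>G\<in>P. \<Sum>x\<in>G. g (s G) - g x))) \<le> real (card F') * exp (l\<^sup>2 * V)"
    by blast
  have "real (card F') \<le> real (card F) + real (card ((\<lambda>g x. - g x) ` F))"
    unfolding F'_def by (metis card_Un_le of_nat_add of_nat_le_iff)
  also have "\<dots> \<le> 2 * M"
    using card_image_le[OF \<open>finite F\<close>, of "\<lambda>g x. - g x"] cF by linarith
  finally have cF': "real (card F') \<le> 2 * M" .
  have "V \<le> (\<Sum>G\<in>P. (B * b)\<^sup>2)"
    unfolding V_def using cG \<open>0 \<le> b\<close> by (intro sum_mono power_mono mult_right_mono) auto
  also have "\<dots> \<le> N * (B * b)\<^sup>2"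
    using cP by (simp add: mult_right_mono)
  finally have V: "V \<le> N * (B * b)\<^sup>2" .
  have up: "(\<Sum>G\<in>P. \<Sum>x\<in>G. g (s G) - g x) \<le> e" if "g \<in> F'" for g
  proof -
    define t where "t = (\<Sum>G\<in>P. \<Sum>x\<in>G. g (s G) - g x)"
    have "exp (l * t) \<le> (\<Sum>g\<in>F'. exp (l * (\<Sum>G\<in>P. \<Sum>x\<in>G. g (s G) - g x)))"
      unfolding t_def using that \<open>finite F'\<close> by (intro member_le_sum) auto
    also have "\<dots> \<le> real (card F') * exp (l\<^sup>2 * V)" by (fact mom)
    also have "\<dots> \<le> 2 * M * exp (l\<^sup>2 * V)" using cF' by (simp add: mult_right_mono)
    also have "\<dots> = exp (ln (2 * M) + l\<^sup>2 * V)" using cF(2) by (simp add: exp_add)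
    finally have "l * t \<le> ln (2 * M) + l\<^sup>2 * V" by simp
    also have "ln (2 * M) = l * (e / 2)" using \<open>0 < e\<close> by (simp add: l_def)
    also have "l * (e / 2) + l\<^sup>2 * V = l * (e / 2 + l * V)" by (simp add: power2_eq_square algebra_simps)
    finally have "t \<le> e / 2 + l * V" using lpos by simp
    also have "l * V \<le> e / 2"
    proof -
      have "4 * V * ln (2 * M) \<le> 4 * (N * (B * b)\<^sup>2) * ln (2 * M)"
        using V lpos(1) by (intro mult_right_mono) auto
      then have "4 * V * ln (2 * M) \<le> e * e" using e by (simp add: power2_eq_square mult_ac)
      then show ?thesis using \<open>0 < e\<close> by (simp add: l_def field_simps)
    qed
    finally show ?thesis by (simp add: t_def)
  qed
  have "\<bar>\<Sum>G\<in>P. \<Sum>x\<in>G. g (s G) - g x\<bar> \<le> e" if "g \<in> F" for g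
  proof -
    have "(\<Sum>G\<in>P. \<Sum>x\<in>G. g (s G) - g x) \<le> e" using up that by (simp add: F'_def)
    moreover have "(\<Sum>G\<in>P. \<Sum>x\<in>G. - g (s G) - - g x) \<le> e"
      using up[of "\<lambda>x. - g x"] that by (auto simp: F'_def)
    moreover have "(\<Sum>G\<in>P. \<Sum>x\<in>G. - g (s G) - - g x) = - (\<Sum>G\<in>P. \<Sum>x\<in>G. g (s G) - g x)"
      by (simp add: sum_negf[symmetric])
    ultimately show ?thesis by linarith
  qed
  with s show ?thesis by blast
qed

section \<open>Partition into groups of bounded size\<close>

text \<open>
  Split off a whole fiber when it has at most \<open>B\<close> points, otherwise \<open>B\<close> points of it: each step
  lowers \<open>card R + B * card (\<kappa> ` R)\<close> by at least \<open>B\<close>.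
\<close>

lemma exists_bounded_partition_refining_fibers:
  fixes \<kappa> :: "'a \<Rightarrow> 'b" and B :: nat
  assumes "finite R" and "B \<ge> 1"
  shows "\<exists>P. \<Union>P = R \<and> disjoint P \<and> {} \<notin> P \<and> (\<forall>G\<in>P. card G \<le> B) \<and>
    (\<forall>G\<in>P. \<forall>x\<in>G. \<forall>x'\<in>G. \<kappa> x = \<kappa> x') \<and> B * card P \<le> card R + B * card (\<kappa> ` R)"
  using assms(1)
proof (induction R rule: finite_psubset_induct)
  case (psubset R)
  show ?case
  proof (cases "R = {}")
    case True
    then show ?thesis by (intro exI[of _ "{}"]) auto
  next
    case False
    then obtain x where x: "x \<in> R" by blast
    define A where "A = {a \<in> R. \<kappa> a = \<kappa> x}"
    have A: "A \<subseteq> R" "finite A" "A \<noteq> {}" using x psubset.hyps by (auto simp: A_def)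
    have "\<exists>H\<subseteq>A. H \<noteq> {} \<and> card H \<le> B \<and>
      card (R - H) + B * card (\<kappa> ` (R - H)) + B \<le> card R + B * card (\<kappa> ` R)"
    proof (cases "card A \<le> B")
      case True
      \<comment> \<open>Removing a whole fiber eliminates its label, which pays \<open>B\<close>
        however few points the fiber has.\<close>
      have "\<kappa> ` (R - A) \<subseteq> \<kappa> ` R - {\<kappa> x}" by (auto simp: A_def)
      then have "card (\<kappa> ` (R - A)) \<le> card (\<kappa> ` R - {\<kappa> x})"
        using psubset.hyps by (intro card_mono) auto
      moreover have "card (\<kappa> ` R) = Suc (card (\<kappa> ` R - {\<kappa> x}))"
        using x psubset.hyps by (metis card.remove finite_imageI imageI)
      ultimately have "Suc (card (\<kappa> ` (R - A))) \<le> card (\<kappa> ` R)" by simp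
      then have "B * Suc (card (\<kappa> ` (R - A))) \<le> B * card (\<kappa> ` R)" by (rule mult_le_mono2)
      moreover have "card (R - A) \<le> card R" using psubset.hyps by (intro card_mono) auto
      ultimately show ?thesis using A True by (intro exI[of _ A]) auto
    next
      case False
      then obtain H where H: "H \<subseteq> A" "card H = B" "finite H"
        using obtain_subset_with_card_n[of B A] by (metis nat_le_linear)
      have "H \<subseteq> R" using H A by blast
      then have "card (R - H) + B = card R"
        using H psubset.hyps by (metis card_Diff_subset card_mono le_add_diff_inverse2)
      moreover have "card (\<kappa> ` (R - H)) \<le> card (\<kappa> ` R)"
        using psubset.hyps by (intro card_mono) auto
      ultimately have "card (R - H) + B * card (\<kappa> ` (R - H)) + B \<le> card R + B * card (\<kappa> ` R)"
        by (metis add.commute add.left_commute add_le_mono1 mult_le_mono2)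
      then show ?thesis using H assms(2) by (intro exI[of _ H]) auto
    qed
    then obtain H where H: "H \<subseteq> A" "H \<noteq> {}" "card H \<le> B"
      "card (R - H) + B * card (\<kappa> ` (R - H)) + B \<le> card R + B * card (\<kappa> ` R)" by blast
    have "R - H \<subset> R" using H A by blast
    then obtain P where P: "\<Union>P = R - H" "disjoint P" "{} \<notin> P" "\<forall>G\<in>P. card G \<le> B"
      "\<forall>G\<in>P. \<forall>x\<in>G. \<forall>x'\<in>G. \<kappa> x = \<kappa> x'"
      "B * card P \<le> card (R - H) + B * card (\<kappa> ` (R - H))"
      using psubset.IH by meson
    have "finite P" using P(1) psubset.hyps by (metis finite_Diff finite_UnionD)
    moreover have "H \<notin> P" using P(1) H(2) by blast
    ultimately have "B * card (insert H P) = B * card P + B" by simp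
    then have 1: "B * card (insert H P) \<le> card R + B * card (\<kappa> ` R)" using P(6) H(4) by linarith
    have 2: "\<Union>(insert H P) = R" using P(1) H(1) A by auto
    have 3: "disjoint (insert H P)" using P(1,2) by (auto simp: disjoint_def)
    have "\<kappa> a = \<kappa> x" if "a \<in> H" for a using H(1) that by (auto simp: A_def)
    then have 4: "\<forall>G\<in>insert H P. \<forall>a\<in>G. \<forall>a'\<in>G. \<kappa> a = \<kappa> a'" using P(5) by (metis insertE)
    have 5: "{} \<notin> insert H P" "\<forall>G\<in>insert H P. card G \<le> B" using P(3,4) H(2,3) by auto
    show ?thesis by (rule exI[of _ "insert H P"]) (intro conjI 1 2 3 4 5)
  qed
qed

section \<open>Lipschitz bounds for powers of distances\<close>

text \<open>Mean value theorem with the derivative bounded at \<open>M\<close>. Differentiability is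
  used only inside the open interval, so an endpoint 0 is harmless.\<close>

lemma abs_powr_diff_le:
  fixes a b M z :: real
  assumes "0 \<le> a" "a \<le> M" "0 \<le> b" "b \<le> M" "1 \<le> z"
  shows "\<bar>a powr z - b powr z\<bar> \<le> z * M powr (z - 1) * \<bar>a - b\<bar>"
proof -
  have *: "b powr z - a powr z \<le> z * M powr (z - 1) * (b - a)"
    if "0 \<le> a" "a < b" "b \<le> M" for a b :: real
  proof -
    have "continuous_on {a..b} (\<lambda>x. x powr z)"
      using assms(5) that by (intro continuous_on_powr') (auto intro!: continuous_intros)
    moreover have "((\<lambda>x. x powr z) has_real_derivative z * x powr (z - 1)) (at x)"
      if "a < x" "x < b" for x
      using that \<open>0 \<le> a\<close> by (intro has_real_derivative_powr) auto
    ultimately obtain \<xi> where \<xi>: "a < \<xi>" "\<xi> < b"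
      "b powr z - a powr z = (b - a) * (z * \<xi> powr (z - 1))"
      using MVT[OF \<open>a < b\<close>, of "\<lambda>x. x powr z"]
      by (metis DERIV_unique real_differentiable_def)
    have "\<xi> powr (z - 1) \<le> M powr (z - 1)"
      using \<xi> that assms by (intro powr_mono2) auto
    then have "(b - a) * (z * \<xi> powr (z - 1)) \<le> (b - a) * (z * M powr (z - 1))"
      using that assms by (intro mult_left_mono) auto
    then show ?thesis using \<xi>(3) by (simp add: mult_ac)
  qed
  have mono: "x powr z \<le> y powr z" if "0 \<le> x" "x \<le> y" for x y :: real
    using that assms by (intro powr_mono2) auto
  consider "a < b" | "a = b" | "b < a" by linarith
  then show ?thesis
  proof cases
    case 1
    then show ?thesis using *[of a b] mono[of a b] assms by simp
  next
    case 3
    then show ?thesis using *[of b a] mono[of b a] assms by simp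
  qed auto
qed

text \<open>Form used for the cost: \<open>W\<close> is the length scale of a centre, and
  \<open>h / W\<close> the relative displacement. Weakening \<open>T powr (z - 1)\<close> to
  \<open>T powr z\<close> keeps later constants uniform.\<close>

lemma abs_powr_diff_le_scaled:
  fixes a b T W h z :: real
  assumes "0 \<le> a" "a \<le> T * W" "0 \<le> b" "b \<le> T * W" "1 \<le> z" "1 \<le> T" "0 < W" "\<bar>a - b\<bar> \<le> h"
  shows "\<bar>a powr z - b powr z\<bar> \<le> z * T powr z * W powr z * (h / W)"
proof -
  have "\<bar>a powr z - b powr z\<bar> \<le> z * (T * W) powr (z - 1) * \<bar>a - b\<bar>"
    using assms by (intro abs_powr_diff_le) auto
  also have "\<dots> \<le> z * (T * W) powr (z - 1) * h"
    using assms by (intro mult_left_mono) auto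
  also have "(T * W) powr (z - 1) = T powr (z - 1) * (W powr z / W)"
    using assms by (simp add: powr_mult powr_diff)
  also have "z * (T powr (z - 1) * (W powr z / W)) * h \<le> z * (T powr z * (W powr z / W)) * h"
    using assms by (intro mult_right_mono mult_left_mono powr_mono) auto
  also have "\<dots> = z * T powr z * W powr z * (h / W)" by simp
  finally show ?thesis .
qed

section \<open>Euclidean distance, nets and grids\<close>

lemma edist_nonneg: "0 \<le> edist d x y"
  by (simp add: edist_def)

lemma edist_commute: "edist d x y = edist d y x"
  by (simp add: edist_def L2_set_def power2_commute)

lemma edist_triangle: "edist d x y \<le> edist d x u + edist d u y"
  using L2_set_triangle_ineq[of "\<lambda>i. x i - u i" "\<lambda>i. u i - y i" "{..<d}"] by (simp add: edist_def)

lemma abs_coord_diff_le_edist: "i < d \<Longrightarrow> \<bar>x i - y i\<bar> \<le> edist d x y"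
  using member_le_L2_set[of "{..<d}" i "\<lambda>i. \<bar>x i - y i\<bar>"] by (simp add: edist_def L2_set_def)

text \<open>Comparison with the sum norm. It loses a factor up to \<open>sqrt d\<close>, which a
  bound polynomial in \<open>d\<close> absorbs.\<close>

lemma edist_le_if_coord_diff_le:
  assumes "\<And>i. i < d \<Longrightarrow> \<bar>x i - y i\<bar> \<le> h"
  shows "edist d x y \<le> real d * h"
proof -
  have "edist d x y \<le> (\<Sum>i<d. \<bar>x i - y i\<bar>)" unfolding edist_def by (rule L2_set_le_sum_abs)
  also have "\<dots> \<le> (\<Sum>i<d. h)" using assms by (intro sum_mono) auto
  finally show ?thesis by simp
qed

text \<open>Each coordinate relative to \<open>c\<close> is rounded down to a multiple of \<eta>.
  There are \<open>2 * J + 1\<close> values per coordinate, and \<open>J\<close> is less than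
  \<open>L / \<eta> + 1\<close>, whence the summand 3.\<close>

lemma exists_finite_net:
  assumes "0 < \<eta>" "0 \<le> L"
  shows "\<exists>Y. finite Y \<and> real (card Y) \<le> (2 * (L / \<eta>) + 3) ^ d \<and>
    (\<forall>y. edist d y c \<le> L \<longrightarrow> (\<exists>y'\<in>Y. edist d y y' \<le> real d * \<eta>))"
proof -
  define J where "J = \<lceil>L / \<eta>\<rceil>"
  define I where "I = PiE {..<d} (\<lambda>_. {-J..J})"
  \<comment> \<open>Net points may be nonzero at indices from \<open>d\<close> on, hence lie outside
    \<open>Rspace d\<close>; \<open>edist d\<close> reads only the first \<open>d\<close>
    coordinates.\<close>
  define pt where "pt g = (\<lambda>i. c i + \<eta> * real_of_int (g i))" for g :: "nat \<Rightarrow> int"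
  have "J \<ge> 0" using assms by (simp add: J_def order.strict_trans2[of _ 0])
  have fin: "finite I" by (auto simp: I_def intro!: finite_PiE)
  have "real (card (pt ` I)) \<le> real (card I)" using fin by (simp add: card_image_le)
  also have "\<dots> = (2 * real_of_int J + 1) ^ d"
    using \<open>J \<ge> 0\<close> by (simp add: I_def card_PiE)
  also have "\<dots> \<le> (2 * (L / \<eta>) + 3) ^ d"
    using \<open>J \<ge> 0\<close> ceiling_correct[of "L / \<eta>"] by (intro power_mono) (auto simp: J_def)
  finally have card: "real (card (pt ` I)) \<le> (2 * (L / \<eta>) + 3) ^ d" .
  have "\<exists>y'\<in>pt ` I. edist d y y' \<le> real d * \<eta>" if y: "edist d y c \<le> L" for y
  proof -
    define g where "g = restrict (\<lambda>i. \<lfloor>(y i - c i) / \<eta>\<rfloor>) {..<d}"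
    have "g \<in> I"
      unfolding I_def g_def
    proof (rule restrict_PiE_iff[THEN iffD2], rule ballI)
      fix i assume "i \<in> {..<d}"
      then have "\<bar>y i - c i\<bar> \<le> L" using abs_coord_diff_le_edist[of i d y c] y by auto
      then have "- L / \<eta> \<le> (y i - c i) / \<eta>" "(y i - c i) / \<eta> \<le> L / \<eta>"
        using assms by (intro divide_right_mono; simp)+
      then have "- (L / \<eta>) \<le> (y i - c i) / \<eta>" "(y i - c i) / \<eta> \<le> L / \<eta>" by auto
      then show "\<lfloor>(y i - c i) / \<eta>\<rfloor> \<in> {-J..J}"
        unfolding J_def ceiling_def
        using floor_mono[of "- (L / \<eta>)" "(y i - c i) / \<eta>"] ceiling_correct[of "L / \<eta>"]
        by (auto simp: floor_le_iff ceiling_def)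
    qed
    moreover have "edist d y (pt g) \<le> real d * \<eta>"
    proof (rule edist_le_if_coord_diff_le)
      fix i assume "i < d"
      define t where "t = (y i - c i) / \<eta>"
      have "y i - pt g i = \<eta> * (t - \<lfloor>t\<rfloor>)"
        using assms \<open>i < d\<close> by (simp add: pt_def g_def t_def field_simps)
      moreover have "0 \<le> t - \<lfloor>t\<rfloor>" "t - \<lfloor>t\<rfloor> \<le> 1" by linarith+
      ultimately show "\<bar>y i - pt g i\<bar> \<le> \<eta>" using assms by (simp add: abs_mult)
    qed
    ultimately show ?thesis by blast
  qed
  with card fin show ?thesis by (intro exI[of _ "pt ` I"]) auto
qed

text \<open>Cells of side \<open>5 * r / k\<close> label the cube of side \<open>4 * r\<close>
  around \<open>c\<close>. Taking 5 rather than 4 keeps the upper boundary strictly below index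
  \<open>k\<close>, so \<open>k\<close> labels per axis suffice.\<close>

lemma exists_grid_labelling:
  assumes "0 < r" "k \<ge> 1"
  shows "\<exists>\<kappa> :: point \<Rightarrow> nat \<Rightarrow> int. \<forall>R. (\<forall>x\<in>R. edist d x c \<le> 2 * r) \<longrightarrow> card (\<kappa> ` R) \<le> k ^ d \<and>
    (\<forall>x\<in>R. \<forall>x'\<in>R. \<kappa> x = \<kappa> x' \<longrightarrow> edist d x x' \<le> real d * (5 * r / real k))"
proof -
  define t where "t x i = (x i - c i + 2 * r) * real k / (5 * r)" for x i
  define \<kappa> :: "point \<Rightarrow> nat \<Rightarrow> int" where "\<kappa> x = restrict (\<lambda>i. \<lfloor>t x i\<rfloor>) {..<d}" for x
  have "card (\<kappa> ` R) \<le> k ^ d" if R: "\<forall>x\<in>R. edist d x c \<le> 2 * r" for R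
  proof -
    have "\<kappa> ` R \<subseteq> PiE {..<d} (\<lambda>_. {0..<int k})"
      unfolding \<kappa>_def
    proof (intro image_subsetI restrict_PiE_iff[THEN iffD2] ballI)
      fix x i assume "x \<in> R" "i \<in> {..<d}"
      then have "\<bar>x i - c i\<bar> \<le> 2 * r" using abs_coord_diff_le_edist[of i d x c] R by force
      then have "0 \<le> x i - c i + 2 * r" "x i - c i + 2 * r < 5 * r" using assms by auto
      then have "0 \<le> t x i" "t x i < real k"
        using assms by (auto simp: t_def divide_less_eq mult_strict_left_mono mult.commute)
      then show "\<lfloor>t x i\<rfloor> \<in> {0..<int k}" by (auto simp: floor_less_iff)
    qed
    then have "card (\<kappa> ` R) \<le> card (PiE {..<d} (\<lambda>_. {0..<int k}))"
      by (intro card_mono finite_PiE) auto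
    then show ?thesis by (simp add: card_PiE)
  qed
  moreover have "edist d x x' \<le> real d * (5 * r / real k)" if "\<kappa> x = \<kappa> x'" for x x'
  proof (rule edist_le_if_coord_diff_le)
    fix i assume "i < d"
    then have "\<lfloor>t x i\<rfloor> = \<lfloor>t x' i\<rfloor>" using fun_cong[OF that, of i] by (simp add: \<kappa>_def)
    then have "\<bar>t x i - t x' i\<bar> \<le> 1" by linarith
    moreover have "t x i - t x' i = (x i - x' i) / (5 * r / real k)"
      using assms by (simp add: t_def field_simps)
    ultimately have "\<bar>x i - x' i\<bar> / (5 * r / real k) \<le> 1" using assms by (simp add: abs_divide)
    then show "\<bar>x i - x' i\<bar> \<le> 5 * r / real k"
      using assms by (subst (asm) divide_le_eq_1_pos) auto
  qed
  ultimately show ?thesis by (intro exI[of _ \<kappa>]) auto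
qed

section \<open>Construction of the coreset for a given target size\<close>

text \<open>\<open>M\<close> bounds the net of centres. \<open>H\<close> is exactly the smallness
  condition of \<open>exists_selection_small_deviation\<close> for \<open>2 * m\<close> groups of at
  most \<open>2 * n / m\<close> points, after the number \<open>n\<close> of points cancels.\<close>

lemma ring_coreset_of_size:
  fixes d :: nat and m z \<epsilon> r :: real
  defines "M \<equiv> (2 * (16 * z\<^sup>2 * 96 powr z * real d / \<epsilon>\<^sup>2) + 3) ^ d"
  assumes "d \<ge> 1" "z \<ge> 1" "0 < \<epsilon>" "\<epsilon> < 1" "r > 0"
    and "finite R" "R \<subseteq> ring_region d c r (2 * r)" "m \<ge> 1"
    and H: "12800 * z\<^sup>2 * 256 powr z * (real d)\<^sup>2 * ln (2 * M) \<le> \<epsilon>\<^sup>2 * m powr (1 + 2 / real d)"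
  shows "\<exists>S w. is_coreset d z \<epsilon> (cost d z R unit_weight c) R unit_weight S w \<and> real (card S) \<le> 2 * m"
\<comment> \<open>A small \<open>R\<close> is its own coreset. Otherwise \<open>n / m > 1\<close>,
  so rounding it up at most doubles it.\<close>
proof (cases "real (card R) \<le> m")
  case True
  have "is_coreset d z \<epsilon> (cost d z R unit_weight c) R unit_weight R unit_weight"
    using assms by (auto simp: is_coreset_def weighted_set_def ring_region_def unit_weight_def cost_def
        intro!: mult_nonneg_nonneg add_nonneg_nonneg sum_nonneg)
  then show ?thesis using True \<open>m \<ge> 1\<close> by (intro exI[of _ R] exI[of _ unit_weight]) auto
next
  case False
  note base = assms(2-6,9)
  define n where "n = real (card R)"
  have n: "n > m" "n > 0" using False \<open>m \<ge> 1\<close> by (auto simp: n_def)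
  have Rc: "r < edist d x c" "edist d x c \<le> 2 * r" "x \<in> Rspace d" if "x \<in> R" for x
    using that assms(8) by (auto simp: ring_region_def)
  define k where "k = nat \<lfloor>m powr (1 / real d)\<rfloor>"
  define B where "B = nat \<lceil>n / m\<rceil>"
  have root: "m powr (1 / real d) \<ge> 1" using \<open>m \<ge> 1\<close> by (simp add: ge_one_powr_ge_zero)
  then have k1: "k \<ge> 1" by (simp add: k_def le_nat_iff)
  have k_le: "real k \<le> m powr (1 / real d)" using root by (simp add: k_def)
  have le_k: "m powr (1 / real d) \<le> 2 * real k" using root k1 unfolding k_def by linarith
  have "real k ^ d \<le> (m powr (1 / real d)) ^ d" using k_le by (intro power_mono) auto
  also have "\<dots> = m" using base by (simp add: powr_power)
  finally have kd: "real k ^ d \<le> m" .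
  have nm: "n / m > 1" using n \<open>m \<ge> 1\<close> by simp
  then have B1: "B \<ge> 1" by (simp add: B_def le_nat_iff)
  have B_le: "real B \<le> 2 * n / m" using nm unfolding B_def by linarith
  have "n / m \<le> real B" unfolding B_def by linarith
  then have n_le: "n \<le> real B * m" using \<open>m \<ge> 1\<close> by (simp add: field_simps)
  obtain \<kappa> :: "point \<Rightarrow> nat \<Rightarrow> int" where \<kappa>: "card (\<kappa> ` R) \<le> k ^ d"
    "\<And>x x'. x \<in> R \<Longrightarrow> x' \<in> R \<Longrightarrow> \<kappa> x = \<kappa> x' \<Longrightarrow> edist d x x' \<le> real d * (5 * r / real k)"
    using exists_grid_labelling[OF \<open>r > 0\<close> k1, of d c] Rc(2) by meson
  obtain P where P: "\<Union>P = R" "disjoint P" "{} \<notin> P" "\<forall>G\<in>P. card G \<le> B"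
    "\<forall>G\<in>P. \<forall>x\<in>G. \<forall>x'\<in>G. \<kappa> x = \<kappa> x'"
    "B * card P \<le> card R + B * card (\<kappa> ` R)"
    using exists_bounded_partition_refining_fibers[OF \<open>finite R\<close> B1, of \<kappa>] by (elim exE conjE) (rule that)
  have finP: "finite P" using P(1) \<open>finite R\<close> by (metis finite_UnionD)
  have finG: "finite G" "G \<subseteq> R" if "G \<in> P" for G
    using that P(1) \<open>finite R\<close> by (auto intro: finite_subset)
  have cP: "real (card P) \<le> 2 * m"
  proof -
    have "real B * real (card P) \<le> n + real B * real (card (\<kappa> ` R))"
      using P(6) unfolding n_def by (metis of_nat_add of_nat_le_iff of_nat_mult)
    also have "\<dots> \<le> real B * m + real B * m"
    proof (intro add_mono n_le mult_left_mono)
      show "real (card (\<kappa> ` R)) \<le> m" using \<kappa>(1) kd by (metis of_nat_le_iff of_nat_power order_trans)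
    qed simp
    finally have "real B * real (card P) \<le> real B * (2 * m)" by (simp add: mult_ac)
    then show ?thesis using B1 by (simp add: mult_le_cancel_left_pos)
  qed
  \<comment> \<open>\<eta> is chosen so that moving a centre to the net changes each summand by at
    most a quarter of the error allowed per point; \<open>L\<close> so that beyond it the diameter
    \<open>4 * r\<close> of the ring alone gives the full allowed error.\<close>
  define \<eta> where "\<eta> = \<epsilon> * r / (4 * z * 12 powr z * real d)"
  define L where "L = 4 * z * 8 powr z * r / \<epsilon>"
  have z0: "z > 0" and d0: "real d > 0" using base by auto
  have \<eta>0: "\<eta> > 0" and L0: "L \<ge> 0" using base z0 by (auto simp: \<eta>_def L_def)
  have "L / \<eta> = 16 * z\<^sup>2 * (8 powr z * 12 powr z) * real d / \<epsilon>\<^sup>2"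
    using base by (simp add: L_def \<eta>_def field_simps power2_eq_square)
  also have "8 powr z * 12 powr z = 96 powr z" by (simp flip: powr_mult)
  finally have M: "M = (2 * (L / \<eta>) + 3) ^ d" by (simp add: M_def)
  obtain Y where Y: "finite Y" "real (card Y) \<le> M"
    "\<And>y. edist d y c \<le> L \<Longrightarrow> \<exists>y'\<in>Y. edist d y y' \<le> real d * \<eta>"
    using exists_finite_net[OF \<eta>0 L0, of d c] unfolding M by blast
  have M1: "M \<ge> 1" unfolding M using \<eta>0 L0 by (intro one_le_power) simp
  define W where "W y = r + edist d y c" for y
  have W: "r \<le> W y" "0 < W y" for y using \<open>r > 0\<close> edist_nonneg[of d y c] by (auto simp: W_def)
  have x_le: "edist d x y \<le> 2 * W y" if "x \<in> R" for x y
    using edist_triangle[of d x y c] Rc(2)[OF that] edist_nonneg[of d y c]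
    by (simp add: W_def edist_commute[of d c y])
  have lip: "\<bar>edist d x y powr z - edist d x' y powr z\<bar> \<le> z * 2 powr z * W y powr z * (edist d x x' / W y)"
    if "x \<in> R" "x' \<in> R" for x x' y
    using edist_triangle[of d x y x'] edist_triangle[of d x' y x] x_le that z0 W base
    by (intro abs_powr_diff_le_scaled edist_nonneg) (auto simp: edist_commute[of d x' x])
  define h where "h y x = edist d x y powr z / W y powr z" for y x
  \<comment> \<open>The cell diameter is at most \<open>5 * d * r / k\<close>, and \<open>k\<close>
    is at least half of \<open>m powr (1 / d)\<close>; this gives the 10.\<close>
  define b where "b = 10 * z * 2 powr z * real d / m powr (1 / real d)"
  have osc: "\<bar>h y x - h y x'\<bar> \<le> b" if "G \<in> P" "x \<in> G" "x' \<in> G" for y G x x'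
  proof -
    have xR: "x \<in> R" "x' \<in> R" using that finG by auto
    have "\<bar>h y x - h y x'\<bar> = \<bar>edist d x y powr z - edist d x' y powr z\<bar> / W y powr z"
      by (simp add: h_def flip: diff_divide_distrib)
    also have "\<dots> \<le> z * 2 powr z * (edist d x x' / W y)"
      using lip[OF xR, of y] W[of y] by (simp add: divide_le_eq mult_ac)
    also have "\<dots> \<le> z * 2 powr z * (edist d x x' / r)"
      using z0 W[of y] \<open>r > 0\<close> edist_nonneg[of d x x'] by (intro mult_left_mono divide_left_mono) auto
    also have "\<dots> \<le> z * 2 powr z * (real d * (5 * r / real k) / r)"
      using z0 \<open>r > 0\<close> \<kappa>(2)[OF xR P(5)[rule_format, OF that]] by (intro mult_left_mono divide_right_mono) auto
    also have "\<dots> = z * 2 powr z * real d * (10 / (2 * real k))"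
      using \<open>r > 0\<close> k1 by (simp add: field_simps)
    also have "\<dots> \<le> z * 2 powr z * real d * (10 / m powr (1 / real d))"
      using z0 le_k root k1 by (intro mult_left_mono divide_left_mono mult_pos_pos) auto
    finally show ?thesis by (simp add: b_def mult_ac)
  qed
  \<comment> \<open>Half of the error budget: a net centre may have scale \<open>W\<close> twice as
    large, and the factor \<open>2 powr z\<close> turns \<open>8 powr z\<close> into
    \<open>4 powr z\<close>.\<close>
  define e where "e = \<epsilon> * n / (2 * 8 powr z)"
  have e0: "e > 0" using base n by (simp add: e_def)
  have small: "4 * (2 * m) * ((2 * n / m) * b)\<^sup>2 * ln (2 * M) \<le> e\<^sup>2"
  proof -
    have m0: "m > 0" using base by simp
    have sq: "(a powr z)\<^sup>2 = (a\<^sup>2) powr z" if "a > 0" for a :: real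
      using that by (simp add: powr_mult power2_eq_square)
    have mp: "m powr (1 + 2 / real d) = m * (m powr (1 / real d))\<^sup>2"
      using m0 by (simp add: powr_add powr_power)
    have pw: "(256::real) powr z = 4 powr z * 64 powr z" by (simp flip: powr_mult)
    have "4 * (2 * m) * ((2 * n / m) * b)\<^sup>2 * ln (2 * M)
      = 3200 * n\<^sup>2 * z\<^sup>2 * (2 powr z)\<^sup>2 * (real d)\<^sup>2 * ln (2 * M) / (m * (m powr (1 / real d))\<^sup>2)"
      using m0 by (simp add: b_def power2_eq_square field_simps)
    also have "\<dots> = 12800 * z\<^sup>2 * 256 powr z * (real d)\<^sup>2 * ln (2 * M) / m powr (1 + 2 / real d)
        * (n\<^sup>2 / (4 * 64 powr z))"
      unfolding mp[symmetric] pw using m0 by (simp add: sq)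
    also have "\<dots> \<le> \<epsilon>\<^sup>2 * (n\<^sup>2 / (4 * 64 powr z))"
      using H m0 by (intro mult_right_mono) (auto simp: divide_le_eq)
    also have "\<dots> = e\<^sup>2"
      by (simp add: e_def power_divide power_mult_distrib sq)
    finally show ?thesis .
  qed
  have cG: "real (card G) \<le> 2 * n / m" if "G \<in> P" for G
    using P(4) that B_le by (smt (verit) of_nat_le_iff)
  have cF: "real (card (h ` Y)) \<le> M"
    using Y(2) card_image_le[OF Y(1), of h] by linarith
  have "b \<ge> 0" using z0 by (simp add: b_def)
  have "\<exists>s. (\<forall>G\<in>P. s G \<in> G) \<and> (\<forall>g\<in>h ` Y. \<bar>\<Sum>G\<in>P. \<Sum>x\<in>G. g (s G) - g x\<bar> \<le> e)"
    by (rule exists_selection_small_deviation[OF finP _ _ _ cG cP cF M1 \<open>b \<ge> 0\<close> e0 small])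
      (use Y(1) finG(1) P(3) osc in blast)+
  then obtain s where s: "\<And>G. G \<in> P \<Longrightarrow> s G \<in> G"
    and dev: "\<And>y. y \<in> Y \<Longrightarrow> \<bar>\<Sum>G\<in>P. \<Sum>x\<in>G. h y (s G) - h y x\<bar> \<le> e" by auto
  have sR: "s G \<in> R" if "G \<in> P" for G using s[OF that] finG[OF that] by blast
  have sum_parts: "(\<Sum>x\<in>R. u x) = (\<Sum>G\<in>P. \<Sum>x\<in>G. u x)" for u :: "point \<Rightarrow> real"
    using sum.Union_disjoint[of P u] finG P(1,2) by (simp add: disjoint_def)
  have sum_le: "\<bar>\<Sum>G\<in>P. \<Sum>x\<in>G. u G x\<bar> \<le> n * q"
    if "\<And>G x. G \<in> P \<Longrightarrow> x \<in> G \<Longrightarrow> \<bar>u G x\<bar> \<le> q" for u :: "point set \<Rightarrow> point \<Rightarrow> real" and q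
  proof -
    have "\<bar>\<Sum>G\<in>P. \<Sum>x\<in>G. u G x\<bar> \<le> (\<Sum>G\<in>P. \<Sum>x\<in>G. \<bar>u G x\<bar>)"
      by (rule order_trans[OF sum_abs]) (intro sum_mono sum_abs)
    also have "\<dots> \<le> (\<Sum>G\<in>P. \<Sum>x\<in>G. q)" using that by (intro sum_mono) auto
    also have "\<dots> = n * q" by (subst sum_parts[symmetric]) (simp add: n_def)
    finally show ?thesis .
  qed
  \<comment> \<open>Signed error of the coreset cost at \<open>y\<close>, written point by point
    against the representative of its group. The target carries \<open>4 powr z\<close> because the
    cost lower bound is in terms of \<open>W y / 4\<close>.\<close>
  define E where "E y = (\<Sum>G\<in>P. \<Sum>x\<in>G. edist d (s G) y powr z - edist d x y powr z)" for y
  have E: "\<bar>E y\<bar> \<le> \<epsilon> / 4 powr z * (n * W y powr z)" for y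
  proof (cases "edist d y c \<le> L")
    case False
    have p8: "(8::real) powr z = 2 powr z * 4 powr z" by (simp flip: powr_mult)
    \<comment> \<open>Far centre: \<open>W y\<close> exceeds \<open>L\<close>, so every single
      replacement is already accurate enough, whatever representative was chosen.\<close>
    have "\<bar>edist d (s G) y powr z - edist d x y powr z\<bar> \<le> \<epsilon> / 4 powr z * W y powr z"
      if "G \<in> P" "x \<in> G" for G x
    proof -
      have xR: "s G \<in> R" "x \<in> R" using that sR finG by auto
      have "edist d (s G) x \<le> 4 * r"
        using edist_triangle[of d "s G" x c] Rc(2)[OF xR(1)] Rc(2)[OF xR(2)]
        by (simp add: edist_commute[of d c x])
      then have "z * 2 powr z * W y powr z * (edist d (s G) x / W y) \<le> z * 2 powr z * W y powr z * (4 * r / L)"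
        using False L0 z0 W[of y] \<open>r > 0\<close> edist_nonneg[of d "s G" x]
        by (intro mult_left_mono frac_le) (auto simp: W_def L_def assms(4))
      also have "\<dots> = \<epsilon> / 4 powr z * W y powr z"
        using z0 \<open>r > 0\<close> assms(4) by (simp add: L_def p8)
      finally show ?thesis by (rule order_trans[OF lip[OF xR]])
    qed
    from sum_le[OF this] show ?thesis by (simp add: E_def mult_ac)
  next
    case True
    then obtain y' where y': "y' \<in> Y" "edist d y y' \<le> real d * \<eta>" using Y(3) by blast
    define D where "D = real d * \<eta>"
    have D: "D = \<epsilon> * r / (4 * z * 12 powr z)" using d0 by (simp add: D_def \<eta>_def)
    have "4 * z * 12 powr z \<ge> 1 * 1" using \<open>z \<ge> 1\<close>
      by (intro mult_mono ge_one_powr_ge_zero) auto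
    then have "\<epsilon> * r / (4 * z * 12 powr z) \<le> r"
      using assms(4,5,6) z0 mult_mono[of \<epsilon> "4 * z * 12 powr z" r r] by (simp add: divide_le_eq mult.commute)
    then have Dr: "D \<le> r" "D \<ge> 0" using \<eta>0 unfolding D[symmetric] by (auto simp: D_def)
    have W': "W y' \<le> 2 * W y"
      using edist_triangle[of d y' c y] y'(2) Dr edist_nonneg[of d y c] \<open>r > 0\<close>
      by (simp add: W_def D_def edist_commute[of d y' y])
    \<comment> \<open>Distances to \<open>y\<close> are at most \<open>2 * W y\<close>, and
      \<open>D \<le> r \<le> W y\<close>, so those to \<open>y'\<close> are at most
      \<open>3 * W y\<close>; hence the base 3.\<close>
    have move: "\<bar>edist d x y powr z - edist d x y' powr z\<bar> \<le> z * 3 powr z * W y powr z * (D / r)"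
      if "x \<in> R" for x
    proof -
      have t: "edist d x y' \<le> edist d x y + D" "edist d x y \<le> edist d x y' + D"
        using edist_triangle[of d x y' y] edist_triangle[of d x y y'] y'(2)
        by (auto simp: D_def edist_commute[of d y' y])
      have "\<bar>edist d x y powr z - edist d x y' powr z\<bar> \<le> z * 3 powr z * W y powr z * (D / W y)"
        using t x_le[OF that, of y] Dr W[of y] \<open>z \<ge> 1\<close>
        by (intro abs_powr_diff_le_scaled edist_nonneg) auto
      also have "\<dots> \<le> z * 3 powr z * W y powr z * (D / r)"
        using W[of y] Dr z0 \<open>r > 0\<close> by (intro mult_left_mono divide_left_mono) auto
      finally show ?thesis .
    qed
    define Q where "Q = \<epsilon> / 4 powr z * W y powr z"
    have p12: "(12::real) powr z = 3 powr z * 4 powr z" by (simp flip: powr_mult)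
    have Dval: "z * 3 powr z * W y powr z * (D / r) = Q / 4"
      using z0 \<open>r > 0\<close> by (simp add: D Q_def p12 field_simps)
    \<comment> \<open>Each summand involves two moved distances, for the point and for its
      representative, each costing \<open>Q / 4\<close>.\<close>
    have "\<bar>E y - E y'\<bar> \<le> n * (Q / 2)"
      unfolding E_def sum_subtractf[symmetric]
    proof (rule sum_le)
      fix G x assume "G \<in> P" "x \<in> G"
      then have "s G \<in> R" "x \<in> R" using sR finG by auto
      from move[OF this(1)] move[OF this(2)] show
        "\<bar>edist d (s G) y powr z - edist d x y powr z - (edist d (s G) y' powr z - edist d x y' powr z)\<bar>
          \<le> Q / 2"
        unfolding Dval by linarith
    qed
    moreover have "\<bar>E y'\<bar> \<le> n * (Q / 2)"
    proof -
      have "E y' = W y' powr z * (\<Sum>G\<in>P. \<Sum>x\<in>G. h y' (s G) - h y' x)"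
        using W(2)[of y'] by (simp add: E_def h_def sum_distrib_left right_diff_distrib)
      then have "\<bar>E y'\<bar> \<le> W y' powr z * e"
        using dev[OF y'(1)] by (simp add: abs_mult mult_left_mono)
      also have "\<dots> \<le> (2 * W y) powr z * e"
        using W' W(2)[of y'] z0 e0 by (intro mult_right_mono powr_mono2) auto
      also have "\<dots> = n * (Q / 2)"
      proof -
        have "(8::real) powr z = 2 powr z * 4 powr z" by (simp flip: powr_mult)
        then show ?thesis using W(2)[of y] by (simp add: e_def Q_def powr_mult mult_ac)
      qed
      finally show ?thesis .
    qed
    moreover have "\<bar>E y\<bar> \<le> \<bar>E y - E y'\<bar> + \<bar>E y'\<bar>" by simp
    ultimately have "\<bar>E y\<bar> \<le> n * (Q / 2) + n * (Q / 2)"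
      by (meson add_mono order_trans)
    also have "\<dots> = \<epsilon> / 4 powr z * (n * W y powr z)" by (simp add: Q_def)
    finally show ?thesis .
  qed
  have low: "n * (W y / 4) powr z \<le> cost d z R unit_weight y + cost d z R unit_weight c" for y
  proof -
    have "(W y / 4) powr z \<le> edist d x y powr z + edist d x c powr z" if "x \<in> R" for x
    proof -
      \<comment> \<open>By the triangle inequality and \<open>r < edist d x c\<close>,
        \<open>W y\<close> is below \<open>edist d x y + 2 * edist d x c\<close>, thus at most three
        times the maximum.\<close>
      have "W y / 4 \<le> max (edist d x y) (edist d x c)"
        using edist_triangle[of d y c x] Rc(1)[OF that] edist_nonneg[of d x y] \<open>r > 0\<close> by (simp add: W_def edist_commute[of d y x] max_def)
      then have "(W y / 4) powr z \<le> max (edist d x y) (edist d x c) powr z"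
        using W(2)[of y] z0 by (intro powr_mono2) auto
      also have "\<dots> \<le> edist d x y powr z + edist d x c powr z" by (simp add: max_def)
      finally show ?thesis .
    qed
    then have "(\<Sum>x\<in>R. (W y / 4) powr z) \<le> (\<Sum>x\<in>R. edist d x y powr z + edist d x c powr z)"
      by (intro sum_mono)
    then show ?thesis by (simp add: cost_def unit_weight_def sum.distrib n_def)
  qed
  have inj: "inj_on s P"
  proof (rule inj_onI)
    fix G H assume "G \<in> P" "H \<in> P" "s G = s H"
    then have "s G \<in> G \<inter> H" using s[of G] s[of H] by simp
    then show "G = H" using disjointD[OF P(2) \<open>G \<in> P\<close> \<open>H \<in> P\<close>] by blast
  qed
  \<comment> \<open>Disjoint groups have distinct representatives, so inverting \<open>s\<close>
    recovers the group whose size is the weight.\<close>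
  define w where "w x = real (card (inv_into P s x))" for x
  have costS: "cost d z (s ` P) w y = cost d z R unit_weight y + E y" for y
  proof -
    have "cost d z (s ` P) w y = (\<Sum>G\<in>P. real (card G) * edist d (s G) y powr z)"
      unfolding cost_def by (simp add: sum.reindex[OF inj] w_def inj)
    moreover have "cost d z R unit_weight y = (\<Sum>G\<in>P. \<Sum>x\<in>G. edist d x y powr z)"
      by (simp add: cost_def unit_weight_def sum_parts)
    ultimately show ?thesis by (simp add: E_def sum_subtractf)
  qed
  have "is_coreset d z \<epsilon> (cost d z R unit_weight c) R unit_weight (s ` P) w"
    unfolding is_coreset_def
  proof (intro conjI ballI)
    show "weighted_set d (s ` P) w"
      using finP sR Rc(3) by (auto simp: weighted_set_def w_def)
    fix y
    have "\<bar>E y\<bar> \<le> \<epsilon> * (n * (W y / 4) powr z)" using E[of y] W(2)[of y] by (simp add: powr_divide)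
    also have "\<dots> \<le> \<epsilon> * (cost d z R unit_weight y + cost d z R unit_weight c)"
      using low assms(4) by (intro mult_left_mono) auto
    finally show "\<bar>cost d z R unit_weight y - cost d z (s ` P) w y\<bar>
        \<le> \<epsilon> * (cost d z R unit_weight y + cost d z R unit_weight c)"
      by (simp add: costS)
  qed
  moreover have "real (card (s ` P)) \<le> 2 * m" using cP by (simp add: card_image[OF inj])
  ultimately show ?thesis by blast
qed

section \<open>Choice of the target size and the final bound\<close>

text \<open>The logarithm of the power gives one factor \<open>d\<close>;
  \<open>ln x \<le> x - 1\<close> for \<open>5 * K\<close> and \<open>d\<close> gives the other, and
  only the dependence on \<epsilon> is kept logarithmic.\<close>

lemma ln_net_size_le:
  fixes d :: nat and K \<epsilon> :: real
  assumes "d \<ge> 1" "K \<ge> 1" "0 < \<epsilon>" "\<epsilon> < 1"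
  shows "ln (2 * (2 * (K * real d / \<epsilon>\<^sup>2) + 3) ^ d) \<le> (5 * K + 2) * (real d)\<^sup>2 * (1 + ln (1 / \<epsilon>))"
proof -
  have d1: "real d \<ge> 1" and l0: "ln (1 / \<epsilon>) > 0" using assms by auto
  have "\<epsilon>\<^sup>2 \<le> 1" using assms by (simp add: power_le_one)
  then have "K * real d / \<epsilon>\<^sup>2 \<ge> 1"
    using assms d1 mult_mono[of 1 K 1 "real d"] by (simp add: le_divide_eq)
  then have "2 * (K * real d / \<epsilon>\<^sup>2) + 3 \<le> 5 * (K * real d / \<epsilon>\<^sup>2)" "2 * (K * real d / \<epsilon>\<^sup>2) + 3 > 0" by linarith+
  then have "ln (2 * (K * real d / \<epsilon>\<^sup>2) + 3) \<le> ln (5 * (K * real d / \<epsilon>\<^sup>2))" by simp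
  also have "\<dots> = ln (5 * K) + ln (real d) + 2 * ln (1 / \<epsilon>)"
    using assms by (simp add: ln_mult ln_div ln_realpow)
  also have "\<dots> \<le> 5 * K + real d + 2 * ln (1 / \<epsilon>)"
    using ln_le_minus_one[of "5 * K"] ln_le_minus_one[of "real d"] assms by auto
  finally have a: "ln (2 * (K * real d / \<epsilon>\<^sup>2) + 3) \<le> 5 * K + real d + 2 * ln (1 / \<epsilon>)" .
  have "ln (2 * (2 * (K * real d / \<epsilon>\<^sup>2) + 3) ^ d) = ln 2 + real d * ln (2 * (K * real d / \<epsilon>\<^sup>2) + 3)"
    using \<open>2 * (K * real d / \<epsilon>\<^sup>2) + 3 > 0\<close> by (simp add: ln_mult ln_realpow)
  also have "\<dots> \<le> real d * 1 + real d * (5 * K + real d + 2 * ln (1 / \<epsilon>))"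
    using a d1 ln_2_less_1 by (intro add_mono mult_left_mono) auto
  also have "\<dots> = real d * ((5 * K + 1) * 1 + real d + 2 * ln (1 / \<epsilon>))" by (simp add: algebra_simps)
  also have "\<dots> \<le> real d * ((5 * K + 1) * real d + real d + (5 * K + 2) * real d * ln (1 / \<epsilon>))"
    using assms d1 l0 mult_mono[of 2 "5 * K + 2" 1 "real d"]
    by (intro mult_left_mono add_mono mult_right_mono) auto
  also have "\<dots> = (5 * K + 2) * (real d)\<^sup>2 * (1 + ln (1 / \<epsilon>))"
    by (simp add: algebra_simps power2_eq_square)
  finally show ?thesis .
qed

theorem theorem5p7:
  shows "\<exists>p q :: nat. \<forall>z::real. z \<ge> 1 \<longrightarrow> (\<exists>C::real. C > 0 \<and>
    (\<forall>(d::nat) (\<epsilon>::real) (c::point) (r::real) (R::point set).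
       d \<ge> 1 \<and> 0 < \<epsilon> \<and> \<epsilon> < 1 \<and> c \<in> Rspace d \<and> r > 0 \<and>
       finite R \<and> R \<subseteq> ring_region d c r (2 * r) \<longrightarrow>
       (\<exists>(S::point set) (w::point \<Rightarrow> real).
          is_coreset d z \<epsilon> (cost d z R unit_weight c) R unit_weight S w \<and>
          real (card S) \<le> C * real d ^ p * (1 + ln (1 / \<epsilon>)) ^ q *
            \<epsilon> powr (- (2 - 2 / (real d + 2))))))"
\<comment> \<open>Exponent 4 of \<open>d\<close>: two from the squared cell diameter and two from
  the logarithm of the net size. That logarithm also gives the single factor
  \<open>1 + ln (1 / \<epsilon>)\<close>.\<close>
proof (rule exI[of _ 4], rule exI[of _ 1], intro allI impI)
  fix z :: real
  assume z: "z \<ge> 1"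
  define K\<^sub>1 where "K\<^sub>1 = 16 * z\<^sup>2 * 96 powr z"
  define K where "K = 12800 * z\<^sup>2 * 256 powr z * (5 * K\<^sub>1 + 2)"
  have p1: "z\<^sup>2 \<ge> 1" "(96::real) powr z \<ge> 1" "(256::real) powr z \<ge> 1"
    using z by (auto simp: ge_one_powr_ge_zero)
  have K\<^sub>1: "K\<^sub>1 \<ge> 1"
    unfolding K\<^sub>1_def using p1 mult_mono[of 1 "16 * z\<^sup>2" 1 "96 powr z"] by simp
  have "1 * 1 * 1 \<le> 12800 * z\<^sup>2 * 256 powr z * (5 * K\<^sub>1 + 2)"
    using p1 K\<^sub>1 by (intro mult_mono) auto
  then have K: "K \<ge> 1" by (simp add: K_def)
  show "\<exists>C>0. \<forall>d \<epsilon> c r R. d \<ge> 1 \<and> 0 < \<epsilon> \<and> \<epsilon> < 1 \<and> c \<in> Rspace d \<and> r > 0 \<and>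
       finite R \<and> R \<subseteq> ring_region d c r (2 * r) \<longrightarrow>
       (\<exists>S w. is_coreset d z \<epsilon> (cost d z R unit_weight c) R unit_weight S w \<and>
          real (card S) \<le> C * real d ^ 4 * (1 + ln (1 / \<epsilon>)) ^ 1 *
            \<epsilon> powr (- (2 - 2 / (real d + 2))))"
  proof (intro exI[of _ "2 * K"] conjI allI impI)
    show "2 * K > 0" using K by simp
    fix d :: nat and \<epsilon> r :: real and c R
    assume "d \<ge> 1 \<and> 0 < \<epsilon> \<and> \<epsilon> < 1 \<and> c \<in> Rspace d \<and> r > 0 \<and>
       finite R \<and> R \<subseteq> ring_region d c r (2 * r)"
    then have d: "d \<ge> 1" and \<epsilon>: "0 < \<epsilon>" "\<epsilon> < 1" and r: "r > 0"
      and R: "finite R" "R \<subseteq> ring_region d c r (2 * r)" by auto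
    define l where "l = 1 + ln (1 / \<epsilon>)"
    \<comment> \<open>\<open>a\<close> bounds the left side of the size condition. Since
      \<open>a \<ge> 1\<close>, raising \<open>m\<close> to \<open>1 + 2 / d\<close> keeps at least
      one factor \<open>a\<close>, so only the power of \<epsilon> remains to be compared.\<close>
    define a where "a = K * real d ^ 4 * l"
    define t where "t = 2 - 2 / (real d + 2)"
    define m where "m = a * \<epsilon> powr (- t)"
    have l: "l \<ge> 1" using \<epsilon> by (simp add: l_def)
    have "1 * 1 * 1 \<le> a" unfolding a_def using K d l by (intro mult_mono) auto
    then have a: "a \<ge> 1" by simp
    have "2 / (real d + 2) \<le> 1" by (simp add: divide_le_eq)
    then have "t \<ge> 0" unfolding t_def by linarith
    then have "\<epsilon> powr 0 \<le> \<epsilon> powr (- t)" using \<epsilon> by (intro powr_mono') auto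
    then have "1 * 1 \<le> m" unfolding m_def using a \<epsilon> by (intro mult_mono) auto
    then have m: "m \<ge> 1" by simp
    \<comment> \<open>This turns the power of \<epsilon> in \<open>m\<close> into at least
      \<open>1 / \<epsilon>\<^sup>2\<close>. The product is \<open>2 + 2 / d\<close>, so there is
      slack; equality with 2 would correspond to \<open>t = 2 * d / (d + 2)\<close>.\<close>
    have t2: "t * (1 + 2 / real d) \<ge> 2"
    proof -
      have "t = 2 * (real d + 1) / (real d + 2)" by (simp add: t_def field_simps)
      moreover have "1 + 2 / real d = (real d + 2) / real d" using d by (simp add: field_simps)
      ultimately have "t * (1 + 2 / real d) = 2 * (real d + 1) / real d" by (simp del: of_nat_add)
      also have "\<dots> = 2 + 2 / real d" using d by (simp add: field_simps)
      finally have "t * (1 + 2 / real d) = 2 + 2 / real d" .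
      then show ?thesis by simp
    qed
    have "\<epsilon> powr (-2) \<le> \<epsilon> powr (- t * (1 + 2 / real d))"
      using t2 \<epsilon> by (intro powr_mono') auto
    moreover have "a powr 1 \<le> a powr (1 + 2 / real d)" using a by (intro powr_mono) auto
    ultimately have "a * \<epsilon> powr (-2) \<le> m powr (1 + 2 / real d)"
      unfolding m_def using a \<epsilon> by (simp add: powr_mult powr_powr mult_mono)
    moreover have "\<epsilon> powr (-2) = 1 / \<epsilon>\<^sup>2" using \<epsilon> by (simp add: powr_minus_divide)
    ultimately have am: "a \<le> \<epsilon>\<^sup>2 * m powr (1 + 2 / real d)"
      using \<epsilon> by (simp add: divide_le_eq mult.commute)
    have "12800 * z\<^sup>2 * 256 powr z * (real d)\<^sup>2 * ln (2 * (2 * (K\<^sub>1 * real d / \<epsilon>\<^sup>2) + 3) ^ d)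
      \<le> 12800 * z\<^sup>2 * 256 powr z * (real d)\<^sup>2 * ((5 * K\<^sub>1 + 2) * (real d)\<^sup>2 * l)"
      unfolding l_def using ln_net_size_le[OF d K\<^sub>1 \<epsilon>] by (intro mult_left_mono) auto
    also have "\<dots> = a" by (simp add: a_def K_def power2_eq_square power4_eq_xxxx)
    finally have "12800 * z\<^sup>2 * 256 powr z * (real d)\<^sup>2 * ln (2 * (2 * (K\<^sub>1 * real d / \<epsilon>\<^sup>2) + 3) ^ d)
      \<le> \<epsilon>\<^sup>2 * m powr (1 + 2 / real d)" using am by linarith
    from ring_coreset_of_size[OF d z \<epsilon> r R m this[unfolded K\<^sub>1_def]]
    show "\<exists>S w. is_coreset d z \<epsilon> (cost d z R unit_weight c) R unit_weight S w \<and>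
          real (card S) \<le> 2 * K * real d ^ 4 * (1 + ln (1 / \<epsilon>)) ^ 1 *
            \<epsilon> powr (- (2 - 2 / (real d + 2)))"
      by (simp add: m_def a_def l_def t_def mult_ac)
  qed
qed

end
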